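(* Let $n\ge1$ be an integer, let $x_i>0$ and $y_i>0$ for $i=1,\ldots,n$, and let $\boldsymbol{\lambda}=(\lambda_1,\ldots,\lambda_n)$ with $\lambda_i>0$ and $\sum_{i=1}^n\lambda_i=1$. Write $\boldsymbol{x}=(x_1,\ldots,x_n)$ and $\boldsymbol{y}=(y_1,\ldots,y_n)$. Then: (i) (harmonic-resolvent-arithmetic mean inequality) $$\big(\lambda_1x_1^{-1}+\cdots+\lambda_nx_n^{-1}\big)^{-1}\le\mathcal{R}(\boldsymbol{x},\boldsymbol{\lambda})\le\lambda_1x_1+\cdots+\lambda_nx_n.$$ Moreover, $\mathcal{R}(\boldsymbol{x},\boldsymbol{\lambda})=\lambda_1x_1+\cdots+\lambda_nx_n$ if and only if $x_1=\cdots=x_n$. (ii) (self-duality) $[\mathcal{R}(\boldsymbol{x},\boldsymbol{\lambda})]^{-1}=\mathcal{R}(\boldsymbol{x}^{-1},\boldsymbol{\lambda})$. (iii) If $\boldsymbol{x}=(x_1,\ldots,x_1)$, then $\mathcal{R}(\boldsymbol{x},\boldsymbol{\lambda})=x_1$. (iv) For the $2n$-tuple $\boldsymbol{z}=(x_1,x_1^{-1},x_2,x_2^{-1},\ldots,x_n,x_n^{-1})$ and the weights $\boldsymbol{\nu}=(\tfrac1{2n},\ldots,\tfrac1{2n})$ ($2n$ entries), one has $\mathcal{R}(\boldsymbol{z},\boldsymbol{\nu})=1$. (v) The function $\boldsymbol{x}\mapsto\mathcal{R}(\boldsymbol{x},\boldsymbol{\lambda})$ is concave on $\mathbb{R}_{++}\times\cdots\times\mathbb{R}_{++}$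 ($n$ factors). (vi) If $\boldsymbol{x}\succeq\boldsymbol{y}$, then $\mathcal{R}(\boldsymbol{x},\boldsymbol{\lambda})\ge\mathcal{R}(\boldsymbol{y},\boldsymbol{\lambda})$.
   Context: For an integer $m\ge1$, $\boldsymbol{x}=(x_1,\ldots,x_m)$ with $x_i\ge0$ and weights $\boldsymbol{\lambda}=(\lambda_1,\ldots,\lambda_m)$ with $\lambda_i>0$, $\sum_i\lambda_i=1$, the scalar resolvent average (with parameter $\mu=1$) is $$\mathcal{R}(\boldsymbol{x},\boldsymbol{\lambda})=\big(\lambda_1(x_1+1)^{-1}+\cdots+\lambda_m(x_m+1)^{-1}\big)^{-1}-1.$$ When all $x_i>0$, $\boldsymbol{x}^{-1}=(1/x_1,\ldots,1/x_m)$. $\mathbb{R}_{++}=\,]0,+\infty[$. $\boldsymbol{x}\succeq\boldsymbol{y}$ means $x_i\ge y_i$ for all $i$. *)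

theory Defs
  imports "HOL-Analysis.Analysis"
begin

text \<open>
  An \<open>m\<close>-tuple of reals is a vector in \<open>real ^ 'm\<close>, with \<open>m = CARD('m)\<close>; hence \<open>m \<ge> 1\<close>.
  The parameter \<open>\<mu>\<close> of the resolvent average is 1.
\<close>

definition resolvent_average :: "real ^ 'm \<Rightarrow> real ^ 'm \<Rightarrow> real" where
  "resolvent_average x l = inverse (\<Sum>i\<in>UNIV. l $ i * inverse (x $ i + 1)) - 1"

definition vec_inverse :: "real ^ 'm \<Rightarrow> real ^ 'm" where
  "vec_inverse x = (\<chi> i. inverse (x $ i))"

text \<open>
  The \<open>2n\<close>-tuple \<open>(x\<^sub>1, 1/x\<^sub>1, \<dots>, x\<^sub>n, 1/x\<^sub>n)\<close>. The position of \<open>x\<^sub>i\<close> is the index \<open>(i, False)\<close>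
  and the position of \<open>1/x\<^sub>i\<close> is the index \<open>(i, True)\<close>.
\<close>

definition with_inverses :: "real ^ 'n \<Rightarrow> real ^ ('n \<times> bool)" where
  "with_inverses x = (\<chi> p. if snd p then inverse (x $ fst p) else x $ fst p)"

lemma CARD_times_bool: "CARD('n::finite \<times> bool) = 2 * CARD('n)"
  by simp

end

theory Submission imports Defs begin

text \<open>
  Shifting by 1 turns the resolvent average into a weighted harmonic mean \<open>H\<close>, so everything rests on
  the weighted AM-HM inequality with its error term: if \<open>c\<close> is the arithmetic mean of \<open>u\<close>, then
  \<open>\<Sum> w / u - 1 / c = \<Sum> w (u - c)\<^sup>2 / (u c\<^sup>2)\<close>.
  Applied to the weights \<open>H(c) w / c\<close>, which again sum to 1, and to the ratios \<open>u / c\<close>, the same inequality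
  says that the graph of \<open>H\<close> lies below its tangent plane at \<open>c\<close>, whence concavity. Self-duality comes from
  \<open>1 / (x + 1) + 1 / (1 / x + 1) = 1\<close>, and it turns the arithmetic bound into the harmonic one.
\<close>

section \<open>Weighted arithmetic and harmonic means of positive reals\<close>

lemma weighted_am_hm_diff:
  fixes w u :: "'a \<Rightarrow> real"
  assumes "finite A" and w: "sum w A = 1" and u: "\<And>i. i \<in> A \<Longrightarrow> 0 < u i"
    and c: "c = (\<Sum>i\<in>A. w i * u i)" and "c \<noteq> 0"
  shows "(\<Sum>i\<in>A. w i * inverse (u i)) - inverse c = (\<Sum>i\<in>A. w i * ((u i - c)\<^sup>2 / (u i * c\<^sup>2)))"
proof -
  have "w i * ((u i - c)\<^sup>2 / (u i * c\<^sup>2)) = w i * inverse (u i) - (2 / c) * w i + (w i * u i) / c\<^sup>2"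
    if "i \<in> A" for i
    using u[OF that] \<open>c \<noteq> 0\<close> by (simp add: field_simps power2_eq_square)
  then have "(\<Sum>i\<in>A. w i * ((u i - c)\<^sup>2 / (u i * c\<^sup>2))) =
      (\<Sum>i\<in>A. w i * inverse (u i)) - (2 / c) * sum w A + (\<Sum>i\<in>A. w i * u i) / c\<^sup>2"
    by (simp add: sum.distrib sum_subtractf sum_distrib_left sum_divide_distrib)
  \<comment> \<open>The weights sum to 1 and the weighted mean of \<open>u\<close> is
    \<open>c\<close>, so the last two terms are \<open>- 2 / c\<close> and
    \<open>1 / c\<close>.\<close>
  also have "\<dots> = (\<Sum>i\<in>A. w i * inverse (u i)) - inverse c"
    unfolding w c[symmetric] using \<open>c \<noteq> 0\<close> by (simp add: divide_inverse power2_eq_square)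
  finally show ?thesis by simp
qed

lemma weighted_sum_pos:
  fixes w u :: "'a \<Rightarrow> real"
  assumes "finite A" "sum w A = 1"
    and "\<And>i. i \<in> A \<Longrightarrow> 0 < w i" and "\<And>i. i \<in> A \<Longrightarrow> 0 < u i"
  shows "0 < (\<Sum>i\<in>A. w i * u i)"
  using assms by (intro sum_pos) auto

text \<open>The error term is a sum of nonnegative summands. It is therefore nonnegative, and it
  vanishes only if each summand does, which forces every \<open>u i\<close> to equal the arithmetic
  mean \<open>c\<close>.\<close>

lemma weighted_am_hm:
  fixes w u :: "'a \<Rightarrow> real"
  assumes fin: "finite A" and w1: "sum w A = 1"
    and w: "\<And>i. i \<in> A \<Longrightarrow> 0 < w i" and u: "\<And>i. i \<in> A \<Longrightarrow> 0 < u i"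
  shows "inverse (\<Sum>i\<in>A. w i * inverse (u i)) \<le> (\<Sum>i\<in>A. w i * u i)"
    and "inverse (\<Sum>i\<in>A. w i * inverse (u i)) = (\<Sum>i\<in>A. w i * u i) \<longleftrightarrow> (\<forall>i\<in>A. \<forall>j\<in>A. u i = u j)"
proof -
  define c where "c = (\<Sum>i\<in>A. w i * u i)"
  define S where "S = (\<Sum>i\<in>A. w i * inverse (u i))"
  have c: "0 < c" and S: "0 < S"
    unfolding c_def S_def using assms by (auto intro!: weighted_sum_pos)
  have diff: "S - inverse c = (\<Sum>i\<in>A. w i * ((u i - c)\<^sup>2 / (u i * c\<^sup>2)))"
    unfolding S_def using weighted_am_hm_diff[OF fin w1 u c_def] c by simp
  have nonneg: "0 \<le> w i * ((u i - c)\<^sup>2 / (u i * c\<^sup>2))" if "i \<in> A" for i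
    using w[OF that] u[OF that] by simp
  have "0 \<le> S - inverse c"
    unfolding diff by (rule sum_nonneg[OF nonneg])
  then have "inverse c \<le> S" by simp
  then show "inverse (\<Sum>i\<in>A. w i * inverse (u i)) \<le> (\<Sum>i\<in>A. w i * u i)"
    unfolding c_def[symmetric] S_def[symmetric] using c le_imp_inverse_le[of "inverse c" S] by simp
  have "inverse S = c \<longleftrightarrow> S - inverse c = 0"
    by auto
  also have "\<dots> \<longleftrightarrow> (\<forall>i\<in>A. w i * ((u i - c)\<^sup>2 / (u i * c\<^sup>2)) = 0)"
    unfolding diff by (rule sum_nonneg_eq_0_iff[OF fin nonneg])
  also have "\<dots> \<longleftrightarrow> (\<forall>i\<in>A. u i = c)"
  proof (intro ball_cong refl)
    fix i assume "i \<in> A"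
    then show "w i * ((u i - c)\<^sup>2 / (u i * c\<^sup>2)) = 0 \<longleftrightarrow> u i = c"
      using w[of i] u[of i] c by auto
  qed
  also have "\<dots> \<longleftrightarrow> (\<forall>i\<in>A. \<forall>j\<in>A. u i = u j)"
  proof
    assume eq: "\<forall>i\<in>A. \<forall>j\<in>A. u i = u j"
    show "\<forall>i\<in>A. u i = c"
    proof
      fix i assume "i \<in> A"
      then have "u j = u i" if "j \<in> A" for j
        using eq that by blast
      then have "c = (\<Sum>j\<in>A. w j * u i)"
        unfolding c_def by (intro sum.cong) auto
      then show "u i = c"
        by (simp add: sum_distrib_right[symmetric] w1)
    qed
  qed simp
  finally show "inverse (\<Sum>i\<in>A. w i * inverse (u i)) = (\<Sum>i\<in>A. w i * u i) \<longleftrightarrow>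
      (\<forall>i\<in>A. \<forall>j\<in>A. u i = u j)"
    unfolding c_def S_def .
qed

text \<open>The harmonic mean is homogeneous of degree 1 with partial derivatives
  \<open>h\<^sup>2 * w i / (c i)\<^sup>2\<close> at \<open>c\<close>, so its tangent plane at
  \<open>c\<close> has no constant term: it is the linear form in \<open>u\<close> on the
  right.\<close>

lemma weighted_hm_le_tangent:
  fixes w u c :: "'a \<Rightarrow> real"
  assumes fin: "finite A" and w1: "sum w A = 1" and w: "\<And>i. i \<in> A \<Longrightarrow> 0 < w i"
    and u: "\<And>i. i \<in> A \<Longrightarrow> 0 < u i" and c: "\<And>i. i \<in> A \<Longrightarrow> 0 < c i"
    and h: "h = inverse (\<Sum>i\<in>A. w i * inverse (c i))"
  shows "inverse (\<Sum>i\<in>A. w i * inverse (u i)) \<le> h\<^sup>2 * (\<Sum>i\<in>A. w i * u i / (c i)\<^sup>2)"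
proof -
  have S: "0 < (\<Sum>i\<in>A. w i * inverse (c i))"
    using assms by (auto intro!: weighted_sum_pos)
  then have h0: "0 < h" by (simp add: h)
  \<comment> \<open>The factor \<open>h\<close> normalizes the weights \<open>w i / c i\<close> to
    total 1.\<close>
  define q where "q i = h * (w i * inverse (c i))" for i
  have "sum q A = h * (\<Sum>i\<in>A. w i * inverse (c i))"
    by (simp add: q_def sum_distrib_left)
  then have q1: "sum q A = 1"
    using S by (simp add: h)
  have "inverse (\<Sum>i\<in>A. q i * inverse (u i / c i)) \<le> (\<Sum>i\<in>A. q i * (u i / c i))"
    by (rule weighted_am_hm(1)[OF fin q1]) (use w u c h0 in \<open>auto simp: q_def\<close>)
  \<comment> \<open>The \<open>c i\<close> in the weight cancels against the one in the inverted
    ratio.\<close>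
  moreover have "(\<Sum>i\<in>A. q i * inverse (u i / c i)) = h * (\<Sum>i\<in>A. w i * inverse (u i))"
    unfolding sum_distrib_left
    by (intro sum.cong refl) (use c in \<open>force simp: q_def field_simps\<close>)
  moreover have "(\<Sum>i\<in>A. q i * (u i / c i)) = h * (\<Sum>i\<in>A. w i * u i / (c i)\<^sup>2)"
    unfolding sum_distrib_left
    by (intro sum.cong refl) (simp add: q_def field_simps power2_eq_square)
  ultimately have "inverse h * inverse (\<Sum>i\<in>A. w i * inverse (u i)) \<le> h * (\<Sum>i\<in>A. w i * u i / (c i)\<^sup>2)"
    by simp
  then have "h * (inverse h * inverse (\<Sum>i\<in>A. w i * inverse (u i)))
      \<le> h * (h * (\<Sum>i\<in>A. w i * u i / (c i)\<^sup>2))"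
    using h0 by (intro mult_left_mono) auto
  then show ?thesis
    using h0 by (simp add: power2_eq_square mult.assoc[symmetric])
qed

text \<open>Both \<open>u\<close> and \<open>v\<close> are bounded by the tangent plane at the
  intermediate point \<open>c\<close>. The bounds are linear, so their convex combination is the
  value of the tangent plane at \<open>c\<close> itself, which is \<open>h\<close>.\<close>

lemma weighted_hm_concave:
  fixes w u v :: "'a \<Rightarrow> real"
  assumes fin: "finite A" and w1: "sum w A = 1" and w: "\<And>i. i \<in> A \<Longrightarrow> 0 < w i"
    and u: "\<And>i. i \<in> A \<Longrightarrow> 0 < u i" and v: "\<And>i. i \<in> A \<Longrightarrow> 0 < v i"
    and st: "0 \<le> s" "0 \<le> t" "s + t = 1"
  shows "s * inverse (\<Sum>i\<in>A. w i * inverse (u i)) + t * inverse (\<Sum>i\<in>A. w i * inverse (v i))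
    \<le> inverse (\<Sum>i\<in>A. w i * inverse (s * u i + t * v i))"
proof -
  define c where "c i = s * u i + t * v i" for i
  define h where "h = inverse (\<Sum>i\<in>A. w i * inverse (c i))"
  \<comment> \<open>One coefficient may be zero: if \<open>s = 0\<close> then \<open>t = 1\<close>,
    otherwise the term with \<open>s\<close> is already positive.\<close>
  have c: "0 < c i" if "i \<in> A" for i
    using u[OF that] v[OF that] st unfolding c_def
    by (cases "s = 0") (auto intro: add_pos_nonneg)
  have S: "0 < (\<Sum>i\<in>A. w i * inverse (c i))"
    using fin w1 w c by (auto intro!: weighted_sum_pos)
  note le = weighted_hm_le_tangent[OF fin w1 w _ c h_def]
  have "s * inverse (\<Sum>i\<in>A. w i * inverse (u i)) + t * inverse (\<Sum>i\<in>A. w i * inverse (v i))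
      \<le> s * (h\<^sup>2 * (\<Sum>i\<in>A. w i * u i / (c i)\<^sup>2)) + t * (h\<^sup>2 * (\<Sum>i\<in>A. w i * v i / (c i)\<^sup>2))"
    using st u v by (intro add_mono mult_left_mono le) auto
  also have "\<dots> = h\<^sup>2 * (\<Sum>i\<in>A. w i * c i / (c i)\<^sup>2)"
    by (simp add: c_def sum_distrib_left sum.distrib[symmetric] algebra_simps add_divide_distrib)
  also have "(\<Sum>i\<in>A. w i * c i / (c i)\<^sup>2) = (\<Sum>i\<in>A. w i * inverse (c i))"
    by (intro sum.cong refl) (use c in \<open>force simp: field_simps power2_eq_square\<close>)
  also have "h\<^sup>2 * \<dots> = h"
    using S by (simp add: h_def power2_eq_square)
  finally show ?thesis
    by (simp add: h_def c_def)
qed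

section \<open>Bounds, duality, concavity and monotonicity of the resolvent average\<close>

lemma resolvent_average_pos:
  fixes x l :: "real ^ 'n"
  assumes x: "\<And>i. 0 < x $ i" and l: "\<And>i. 0 < l $ i" and l1: "(\<Sum>i\<in>UNIV. l $ i) = 1"
  shows "0 < resolvent_average x l"
proof -
  \<comment> \<open>Each \<open>inverse (x $ i + 1)\<close> is below 1, so the weighted sum is below
    1 and its inverse exceeds 1.\<close>
  have "(\<Sum>i\<in>UNIV. l $ i * inverse (x $ i + 1)) < (\<Sum>i\<in>UNIV. l $ i)"
  proof (rule sum_strict_mono)
    show "l $ i * inverse (x $ i + 1) < l $ i" for i
      using x[of i] l[of i] by (simp add: field_simps)
  qed auto
  moreover have "0 < (\<Sum>i\<in>UNIV. l $ i * inverse (x $ i + 1))"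
    using l1 l x by (auto intro!: weighted_sum_pos add_pos_pos)
  ultimately show ?thesis
    using l1 by (simp add: resolvent_average_def one_less_inverse)
qed

text \<open>Adding 1 to every entry raises the arithmetic mean by exactly 1, so AM-HM for the
  shifted entries, with its equality case, gives both claims after subtracting 1.\<close>

lemma resolvent_average_le_arithmetic_mean:
  fixes x l :: "real ^ 'n"
  assumes x: "\<And>i. 0 < x $ i" and l: "\<And>i. 0 < l $ i" and l1: "(\<Sum>i\<in>UNIV. l $ i) = 1"
  shows "resolvent_average x l \<le> (\<Sum>i\<in>UNIV. l $ i * x $ i)"
    and "resolvent_average x l = (\<Sum>i\<in>UNIV. l $ i * x $ i) \<longleftrightarrow> (\<forall>i j. x $ i = x $ j)"
proof -
  have sum1: "(\<Sum>i\<in>UNIV. l $ i * (x $ i + 1)) = (\<Sum>i\<in>UNIV. l $ i * x $ i) + 1"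
    by (simp add: distrib_left sum.distrib l1)
  have x1: "0 < x $ i + 1" for i
    using x[of i] by simp
  note am_hm = weighted_am_hm[of UNIV "\<lambda>i. l $ i" "\<lambda>i. x $ i + 1", OF finite l1 l x1]
  show "resolvent_average x l \<le> (\<Sum>i\<in>UNIV. l $ i * x $ i)"
    using am_hm(1) unfolding sum1 resolvent_average_def by simp
  show "resolvent_average x l = (\<Sum>i\<in>UNIV. l $ i * x $ i) \<longleftrightarrow> (\<forall>i j. x $ i = x $ j)"
    using am_hm(2) unfolding sum1 resolvent_average_def by (simp add: algebra_simps)
qed

lemma inverse_inverse_plus_one:
  fixes a :: real
  assumes "0 < a"
  shows "inverse (inverse a + 1) = 1 - inverse (a + 1)"
proof -
  have "a \<noteq> 0" "a + 1 \<noteq> 0" "1 + a \<noteq> 0"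
    using assms by auto
  then show ?thesis
    by (simp add: divide_simps)
qed

lemma resolvent_average_self_dual:
  fixes x l :: "real ^ 'n"
  assumes x: "\<And>i. 0 < x $ i" and l: "\<And>i. 0 < l $ i" and l1: "(\<Sum>i\<in>UNIV. l $ i) = 1"
  shows "inverse (resolvent_average x l) = resolvent_average (vec_inverse x) l"
proof -
  define S where "S = (\<Sum>i\<in>UNIV. l $ i * inverse (x $ i + 1))"
  have S: "0 < S"
    unfolding S_def using l1 l x by (auto intro!: weighted_sum_pos add_pos_pos)
  have R: "resolvent_average x l = inverse S - 1"
    by (simp add: resolvent_average_def S_def)
  \<comment> \<open>\<open>S = 1\<close> would make the average 0. Excluding it makes
    \<open>inverse (1 - S)\<close> a genuine reciprocal.\<close>
  with resolvent_average_pos[OF assms] have "S \<noteq> 1"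
    by auto
  have "(\<Sum>i\<in>UNIV. l $ i * inverse (vec_inverse x $ i + 1)) = 1 - S"
    by (simp add: vec_inverse_def inverse_inverse_plus_one x right_diff_distrib sum_subtractf l1 S_def)
  then have "resolvent_average (vec_inverse x) l = inverse (1 - S) - 1"
    by (simp add: resolvent_average_def)
  \<comment> \<open>Both sides equal \<open>S / (1 - S)\<close>.\<close>
  with S \<open>S \<noteq> 1\<close> show ?thesis
    unfolding R by (simp add: field_simps)
qed

lemma harmonic_mean_le_resolvent_average:
  fixes x l :: "real ^ 'n"
  assumes x: "\<And>i. 0 < x $ i" and l: "\<And>i. 0 < l $ i" and l1: "(\<Sum>i\<in>UNIV. l $ i) = 1"
  shows "inverse (\<Sum>i\<in>UNIV. l $ i * inverse (x $ i)) \<le> resolvent_average x l"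
proof -
  have "inverse (resolvent_average x l) \<le> (\<Sum>i\<in>UNIV. l $ i * vec_inverse x $ i)"
    unfolding resolvent_average_self_dual[OF assms]
    by (rule resolvent_average_le_arithmetic_mean(1)[OF _ l l1]) (simp add: vec_inverse_def x)
  then have "inverse (resolvent_average x l) \<le> (\<Sum>i\<in>UNIV. l $ i * inverse (x $ i))"
    by (simp add: vec_inverse_def)
  then show ?thesis
    using le_imp_inverse_le[of "inverse (resolvent_average x l)"] resolvent_average_pos[OF assms] by simp
qed

lemma resolvent_average_const:
  fixes l :: "real ^ 'n"
  assumes "(\<Sum>i\<in>UNIV. l $ i) = 1"
  shows "resolvent_average (\<chi> i. c) l = c"
  by (simp add: resolvent_average_def sum_distrib_right[symmetric] assms)

text \<open>Each pair of an entry and its reciprocal contributes resolvents adding up to 1. With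
  \<open>n\<close> pairs and the common weight \<open>1 / (2 * n)\<close>, the weighted sum is
  \<open>1 / 2\<close>, and the average is \<open>2 - 1\<close>.\<close>

lemma resolvent_average_with_inverses:
  fixes x :: "real ^ 'n"
  assumes x: "\<And>i. 0 < x $ i"
  shows "resolvent_average (with_inverses x) (\<chi> p. 1 / (2 * real CARD('n))) = 1"
proof -
  let ?n = "real CARD('n)"
  have "(\<Sum>p\<in>UNIV. (\<chi> p. 1 / (2 * ?n)) $ p * inverse (with_inverses x $ p + 1))
      = (\<Sum>i\<in>UNIV. \<Sum>b\<in>UNIV. 1 / (2 * ?n) * inverse (with_inverses x $ (i, b) + 1))"
    by (simp add: UNIV_Times_UNIV[symmetric] sum.cartesian_product del: UNIV_Times_UNIV)
  also have "\<dots> = (\<Sum>i\<in>(UNIV :: 'n set). 1 / (2 * ?n))"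
    by (simp add: UNIV_bool with_inverses_def inverse_inverse_plus_one x diff_divide_distrib)
  also have "\<dots> = 1 / 2"
    by simp
  finally have half: "(\<Sum>p\<in>UNIV. (\<chi> p. 1 / (2 * ?n)) $ p * inverse (with_inverses x $ p + 1)) = 1 / 2" .
  show ?thesis
    unfolding resolvent_average_def half by simp
qed

lemma concave_on_resolvent_average:
  fixes l :: "real ^ 'n"
  assumes l: "\<And>i. 0 < l $ i" and l1: "(\<Sum>i\<in>UNIV. l $ i) = 1"
  shows "concave_on {v :: real ^ 'n. \<forall>i. 0 < v $ i} (\<lambda>v. resolvent_average v l)"
  unfolding concave_on_iff
proof (intro conjI ballI allI impI)
  show "convex {v :: real ^ 'n. \<forall>i. 0 < v $ i}"
    unfolding convex_def
  proof (clarsimp)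
    fix u v :: "real ^ 'n" and s t :: real and i
    assume "\<forall>i. 0 < u $ i" "\<forall>i. 0 < v $ i" and st: "0 \<le> s" "0 \<le> t" "s + t = 1"
    then have "0 < u $ i" "0 < v $ i" by auto
    with st show "0 < s * u $ i + t * v $ i"
      by (cases "s = 0") (auto intro: add_pos_nonneg)
  qed
next
  fix u v :: "real ^ 'n" and s t :: real
  assume u: "u \<in> {v. \<forall>i. 0 < v $ i}" and v: "v \<in> {v. \<forall>i. 0 < v $ i}"
    and st: "0 \<le> s" "0 \<le> t" "s + t = 1"
  \<comment> \<open>Because \<open>s + t = 1\<close>, the shift by 1 commutes with convex
    combinations, so concavity passes from the harmonic mean to the resolvent average.\<close>
  have shift: "s * (a + 1) + t * (b + 1) = (s * a + t * b) + 1" for a b :: real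
    using st by (simp add: algebra_simps)
  have u1: "0 < u $ i + 1" and v1: "0 < v $ i + 1" for i
    using u v by (auto intro: add_pos_pos)
  show "s * resolvent_average u l + t * resolvent_average v l
      \<le> resolvent_average (s *\<^sub>R u + t *\<^sub>R v) l"
    using weighted_hm_concave[of UNIV "\<lambda>i. l $ i" "\<lambda>i. u $ i + 1" "\<lambda>i. v $ i + 1",
        OF finite l1 l u1 v1 st] st(3)
    unfolding shift by (simp add: resolvent_average_def right_diff_distrib)
qed

text \<open>Inversion reverses the order twice, once in each entry and once on the positive weighted
  sum.\<close>

lemma resolvent_average_mono:
  fixes x y l :: "real ^ 'n"
  assumes y: "\<And>i. 0 < y $ i" and l: "\<And>i. 0 < l $ i" and l1: "(\<Sum>i\<in>UNIV. l $ i) = 1"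
    and le: "\<And>i. y $ i \<le> x $ i"
  shows "resolvent_average y l \<le> resolvent_average x l"
proof -
  have x: "0 < x $ i" for i
    using y le less_le_trans by blast
  have "(\<Sum>i\<in>UNIV. l $ i * inverse (x $ i + 1)) \<le> (\<Sum>i\<in>UNIV. l $ i * inverse (y $ i + 1))"
    using y l le by (intro sum_mono mult_left_mono le_imp_inverse_le) (auto intro: add_pos_pos less_imp_le)
  moreover have "0 < (\<Sum>i\<in>UNIV. l $ i * inverse (x $ i + 1))"
    using l1 l x by (auto intro!: weighted_sum_pos add_pos_pos)
  ultimately show ?thesis
    by (simp add: resolvent_average_def le_imp_inverse_le)
qed

theorem proposition5p1:
  fixes x y l :: "real ^ 'n"
  assumes x_pos: "\<And>i. 0 < x $ i"
    and y_pos: "\<And>i. 0 < y $ i"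
    and l_pos: "\<And>i. 0 < l $ i"
    and l_sum: "(\<Sum>i\<in>UNIV. l $ i) = 1"
  shows
    "(inverse (\<Sum>i\<in>UNIV. l $ i * inverse (x $ i)) \<le> resolvent_average x l
      \<and> resolvent_average x l \<le> (\<Sum>i\<in>UNIV. l $ i * x $ i)
      \<and> (resolvent_average x l = (\<Sum>i\<in>UNIV. l $ i * x $ i) \<longleftrightarrow> (\<forall>i j. x $ i = x $ j)))
   \<and> inverse (resolvent_average x l) = resolvent_average (vec_inverse x) l
   \<and> (\<forall>c. x = (\<chi> i. c) \<longrightarrow> resolvent_average x l = c)
   \<and> resolvent_average (with_inverses x) (\<chi> p. 1 / (2 * real CARD('n))) = 1
   \<and> concave_on {v :: real ^ 'n. \<forall>i. 0 < v $ i} (\<lambda>v. resolvent_average v l)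
   \<and> ((\<forall>i. x $ i \<ge> y $ i) \<longrightarrow> resolvent_average x l \<ge> resolvent_average y l)"
proof (intro conjI)
  show "inverse (\<Sum>i\<in>UNIV. l $ i * inverse (x $ i)) \<le> resolvent_average x l"
    using x_pos l_pos l_sum by (rule harmonic_mean_le_resolvent_average)
  show "resolvent_average x l \<le> (\<Sum>i\<in>UNIV. l $ i * x $ i)"
    using x_pos l_pos l_sum by (rule resolvent_average_le_arithmetic_mean(1))
  show "resolvent_average x l = (\<Sum>i\<in>UNIV. l $ i * x $ i) \<longleftrightarrow> (\<forall>i j. x $ i = x $ j)"
    using x_pos l_pos l_sum by (rule resolvent_average_le_arithmetic_mean(2))
  show "inverse (resolvent_average x l) = resolvent_average (vec_inverse x) l"
    using x_pos l_pos l_sum by (rule resolvent_average_self_dual)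
  show "\<forall>c. x = (\<chi> i. c) \<longrightarrow> resolvent_average x l = c"
    using resolvent_average_const[OF l_sum] by blast
  show "resolvent_average (with_inverses x) (\<chi> p. 1 / (2 * real CARD('n))) = 1"
    using x_pos by (rule resolvent_average_with_inverses)
  show "concave_on {v :: real ^ 'n. \<forall>i. 0 < v $ i} (\<lambda>v. resolvent_average v l)"
    using l_pos l_sum by (rule concave_on_resolvent_average)
  show "(\<forall>i. x $ i \<ge> y $ i) \<longrightarrow> resolvent_average x l \<ge> resolvent_average y l"
    using resolvent_average_mono[OF y_pos l_pos l_sum] by blast
qed

end
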